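(* Consider the spatial economy with immobile labor described in the context, with $\alpha<1$, $\alpha\ne0$, $\delta>0$, and let $\mathcal{F}:\mathbb{R}_{++}^{n+1}\to\mathbb{R}$ be $$\mathcal{F}(p)=-\sum_{i=1}^nV(q,p_i,\omega_i)\,L_i^M-\int_XV(x,p)\,L^A(x)\,dx .$$ Then $p\in\mathbb{R}_{++}^{n+1}$ is an equilibrium (that is, $Z_i(p)=0$ for all $i=1,\dots,n+1$) if and only if $\nabla\mathcal{F}(p)=0$.
   Context: Notation: $\mathbb{R}_+=[0,\infty)$, $\mathbb{R}_{++}=(0,\infty)$, $|\cdot|$ is Lebesgue measure. Geography. $X\subset\mathbb{R}^2$ is open, bounded, connected, with Lipschitz boundary; $S=\{s_1,\dots,s_n\}\subset X$ is a finite set of cities; for each $s\in S$, $d_s:\mathbb{R}^2\to\mathbb{R}_+$ is continuous, and $d_i:=d_{s_i}$. For $s\ne t\in S$, $\gamma\in\mathbb{R}$, put $R_\gamma(s,t)=\{x\in\mathbb{R}^2: d_s(x)-d_t(x)<\gamma\}$. The system $(d_s)_{s\in S}$ is assumed admissible: for all $s\neq t\in S$ and each bounded open $C\subset\mathbb{R}^2$ there are constants $m_{st}<M_{st}$ such that $\gamma\mapsto|C\cap R_\gamma(s,t)|$ is continuously increasing from $0$ to $|C|$ as $\gamma$ grows from $m_{st}$ to $M_{st}$, with $C\cap R_\gamma(s,t)=\emptyset$ if $\gamma\le m_{st}$ and $C\subset R_\gamma(s,t)$ if $\gamma\ge M_{st}$. For $\lambda\in\mathbb{R}^n$, $\Omega_i(\lambda)=X\cap\bigcap_{j\ne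 i}R_{\lambda_i-\lambda_j}(s_i,s_j)$. Economy. $y^a:X\to\mathbb{R}_+$ is continuous with $0<y^a_{\min}\le y^a(x)\le y^a_{\max}$; $y_i^m>0$ and $L_i^M>0$ for $i=1,\dots,n$; $L^A:X\to\mathbb{R}_+$ is continuous, positive, and bounded from below by a positive constant. Shipping costs are $\Delta(x,s_i)=\exp(\delta d_i(x))$. Prices: $p=(p_1,\dots,p_n,q)\in\mathbb{R}_{++}^{n+1}$. Demands for price pair $(q,p_i)$ and income $\omega$ are $$c^m(q,p_i,\omega)=\frac{p_i^{\frac{\alpha}{1-\alpha}}}{p_i^{\frac{\alpha}{1-\alpha}}+q^{\frac{\alpha}{1-\alpha}}}\frac{\omega}{q},\qquad c^a(q,p_i,\omega)=\frac{q^{\frac{\alpha}{1-\alpha}}}{p_i^{\frac{\alpha}{1-\alpha}}+q^{\frac{\alpha}{1-\alpha}}}\frac{\omega}{p_i}.$$ Incomes are $\omega_i=q\,y_i^m$ and $\omega(x,s_i)=p_iy^a(x)/\Delta(x,s_i)$. Indirect utility: $V(q,p_i,\omega)=\bigl(q^{-\frac{\alpha}{1-\alpha}}+p_i^{-\frac{\alpha}{1-\alpha}}\bigr)^{\frac{1-\alpha}{\alpha}}\omega$, and $V(x,p)=\max_{i=1,\dots,n}V(q,p_i,\omega(x,s_i))$ for $x\in X$. The Voronoi weights are $\lambda_i(p)=\frac1\delta\frac{1-\alpha}{\alpha}\log\bigl(1+(p_i/q)^{\frac{\alpha}{1-\alpha}}\bigr)$. Excess demands: for $i=1,\dots,n$,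 $$Z_i(p)=c^a(q,p_i,\omega_i)L_i^M+\int_{\Omega_i(\lambda(p))}\Bigl[c^a(q,p_i,\omega(x,s_i))-\frac{y^a(x)}{\Delta(x,s_i)}\Bigr]L^A(x)\,dx,$$ $$Z_{n+1}(p)=\sum_{i=1}^n\Bigl[(c^m(q,p_i,\omega_i)-y_i^m)L_i^M+\int_{\Omega_i(\lambda(p))}c^m(q,p_i,\omega(x,s_i))L^A(x)\,dx\Bigr].$$ *)

theory Defs
  imports "HOL-Analysis.Analysis"
begin

(* Near every boundary point the set is, after an orthogonal change of coordinates,
   the strict epigraph of a Lipschitz function of one variable. *)
definition lipschitz_boundary :: "(real^2) set \<Rightarrow> bool" where
  "lipschitz_boundary X \<longleftrightarrow>
    (\<forall>z\<in>frontier X. \<exists>r>0. \<exists>T :: real^2 \<Rightarrow> real^2. \<exists>\<phi>::real \<Rightarrow> real. \<exists>L.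
       orthogonal_transformation T \<and> L-lipschitz_on UNIV \<phi> \<and>
       X \<inter> ball z r = {x \<in> ball z r. \<phi> (T x $ 1) < T x $ 2})"

definition R :: "(real^2 \<Rightarrow> real^2 \<Rightarrow> real) \<Rightarrow> real \<Rightarrow> real^2 \<Rightarrow> real^2 \<Rightarrow> (real^2) set" where
  "R d \<gamma> s t = {x. d s x - d t x < \<gamma>}"

(* "Increasing" is meant in the weak sense: C may be disconnected, and then the measure is
   in general constant on some intervals, even for Euclidean distances.  That it grows from
   0 to the measure of C is contained in the last two conjuncts (at m and at M). *)
definition admissible :: "(real^2) set \<Rightarrow> (real^2 \<Rightarrow> real^2 \<Rightarrow> real) \<Rightarrow> bool" where
  "admissible S d \<longleftrightarrow>
    (\<forall>s\<in>S. \<forall>t\<in>S. s \<noteq> t \<longrightarrow>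
      (\<forall>C. open C \<and> bounded C \<longrightarrow>
        (\<exists>m M. m < M \<and>
           continuous_on {m..M} (\<lambda>\<gamma>. measure lebesgue (C \<inter> R d \<gamma> s t)) \<and>
           mono_on {m..M} (\<lambda>\<gamma>. measure lebesgue (C \<inter> R d \<gamma> s t)) \<and>
           (\<forall>\<gamma>\<le>m. C \<inter> R d \<gamma> s t = {}) \<and>
           (\<forall>\<gamma>\<ge>M. C \<subseteq> R d \<gamma> s t))))"

definition Omega ::
  "(real^2) set \<Rightarrow> (real^2 \<Rightarrow> real^2 \<Rightarrow> real) \<Rightarrow> ('n \<Rightarrow> real^2) \<Rightarrow> real^'n \<Rightarrow> 'n \<Rightarrow> (real^2) set" where
  "Omega X d s lam i = X \<inter> (\<Inter>j\<in>{j. j \<noteq> i}. R d (lam $ i - lam $ j) (s i) (s j))"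

definition shipping :: "real \<Rightarrow> (real^2 \<Rightarrow> real^2 \<Rightarrow> real) \<Rightarrow> real^2 \<Rightarrow> real^2 \<Rightarrow> real" where
  "shipping \<delta> d x t = exp (\<delta> * d t x)"

(* In the following, pr = (p, q) stands for the price vector: fst pr $ i is the price of the
   agricultural good of city i, snd pr the price of the manufactured good. *)

definition positive_prices :: "(real^'n) \<times> real \<Rightarrow> bool" where
  "positive_prices pr \<longleftrightarrow> (\<forall>i. 0 < fst pr $ i) \<and> 0 < snd pr"

definition demand_m :: "real \<Rightarrow> real \<Rightarrow> real \<Rightarrow> real \<Rightarrow> real" where
  "demand_m \<alpha> q p \<omega> =
     p powr (\<alpha> / (1 - \<alpha>)) / (p powr (\<alpha> / (1 - \<alpha>)) + q powr (\<alpha> / (1 - \<alpha>))) * (\<omega> / q)"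

definition demand_a :: "real \<Rightarrow> real \<Rightarrow> real \<Rightarrow> real \<Rightarrow> real" where
  "demand_a \<alpha> q p \<omega> =
     q powr (\<alpha> / (1 - \<alpha>)) / (p powr (\<alpha> / (1 - \<alpha>)) + q powr (\<alpha> / (1 - \<alpha>))) * (\<omega> / p)"

definition utility :: "real \<Rightarrow> real \<Rightarrow> real \<Rightarrow> real \<Rightarrow> real" where
  "utility \<alpha> q p \<omega> =
     (q powr (- (\<alpha> / (1 - \<alpha>))) + p powr (- (\<alpha> / (1 - \<alpha>)))) powr ((1 - \<alpha>) / \<alpha>) * \<omega>"

definition urban_income :: "('n \<Rightarrow> real) \<Rightarrow> (real^'n) \<times> real \<Rightarrow> 'n \<Rightarrow> real" where
  "urban_income ym pr i = snd pr * ym i"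

definition rural_income ::
  "real \<Rightarrow> (real^2 \<Rightarrow> real^2 \<Rightarrow> real) \<Rightarrow> ('n \<Rightarrow> real^2) \<Rightarrow> (real^2 \<Rightarrow> real)
    \<Rightarrow> (real^'n) \<times> real \<Rightarrow> real^2 \<Rightarrow> 'n \<Rightarrow> real" where
  "rural_income \<delta> d s ya pr x i = fst pr $ i * ya x / shipping \<delta> d x (s i)"

definition rural_utility ::
  "real \<Rightarrow> real \<Rightarrow> (real^2 \<Rightarrow> real^2 \<Rightarrow> real) \<Rightarrow> ('n::finite \<Rightarrow> real^2) \<Rightarrow> (real^2 \<Rightarrow> real)
    \<Rightarrow> real^2 \<Rightarrow> (real^'n) \<times> real \<Rightarrow> real" where
  "rural_utility \<alpha> \<delta> d s ya x pr =
     Max (range (\<lambda>i. utility \<alpha> (snd pr) (fst pr $ i) (rural_income \<delta> d s ya pr x i)))"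

definition voronoi_weights :: "real \<Rightarrow> real \<Rightarrow> (real^'n) \<times> real \<Rightarrow> real^'n" where
  "voronoi_weights \<alpha> \<delta> pr =
     (\<chi> i. 1 / \<delta> * ((1 - \<alpha>) / \<alpha>) * ln (1 + (fst pr $ i / snd pr) powr (\<alpha> / (1 - \<alpha>))))"

definition excess_agricultural ::
  "real \<Rightarrow> real \<Rightarrow> (real^2) set \<Rightarrow> (real^2 \<Rightarrow> real^2 \<Rightarrow> real) \<Rightarrow> ('n \<Rightarrow> real^2)
    \<Rightarrow> (real^2 \<Rightarrow> real) \<Rightarrow> ('n \<Rightarrow> real) \<Rightarrow> (real^2 \<Rightarrow> real) \<Rightarrow> ('n \<Rightarrow> real)
    \<Rightarrow> (real^'n) \<times> real \<Rightarrow> 'n \<Rightarrow> real" where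
  "excess_agricultural \<alpha> \<delta> X d s ya ym LA LM pr i =
     demand_a \<alpha> (snd pr) (fst pr $ i) (urban_income ym pr i) * LM i +
     (LINT x : Omega X d s (voronoi_weights \<alpha> \<delta> pr) i | lebesgue.
        (demand_a \<alpha> (snd pr) (fst pr $ i) (rural_income \<delta> d s ya pr x i)
          - ya x / shipping \<delta> d x (s i)) * LA x)"

definition excess_manufactured ::
  "real \<Rightarrow> real \<Rightarrow> (real^2) set \<Rightarrow> (real^2 \<Rightarrow> real^2 \<Rightarrow> real) \<Rightarrow> ('n::finite \<Rightarrow> real^2)
    \<Rightarrow> (real^2 \<Rightarrow> real) \<Rightarrow> ('n \<Rightarrow> real) \<Rightarrow> (real^2 \<Rightarrow> real) \<Rightarrow> ('n \<Rightarrow> real)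
    \<Rightarrow> (real^'n) \<times> real \<Rightarrow> real" where
  "excess_manufactured \<alpha> \<delta> X d s ya ym LA LM pr =
     (\<Sum>i\<in>UNIV.
        (demand_m \<alpha> (snd pr) (fst pr $ i) (urban_income ym pr i) - ym i) * LM i +
        (LINT x : Omega X d s (voronoi_weights \<alpha> \<delta> pr) i | lebesgue.
           demand_m \<alpha> (snd pr) (fst pr $ i) (rural_income \<delta> d s ya pr x i) * LA x))"

definition equilibrium ::
  "real \<Rightarrow> real \<Rightarrow> (real^2) set \<Rightarrow> (real^2 \<Rightarrow> real^2 \<Rightarrow> real) \<Rightarrow> ('n::finite \<Rightarrow> real^2)
    \<Rightarrow> (real^2 \<Rightarrow> real) \<Rightarrow> ('n \<Rightarrow> real) \<Rightarrow> (real^2 \<Rightarrow> real) \<Rightarrow> ('n \<Rightarrow> real)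
    \<Rightarrow> (real^'n) \<times> real \<Rightarrow> bool" where
  "equilibrium \<alpha> \<delta> X d s ya ym LA LM pr \<longleftrightarrow>
     (\<forall>i. excess_agricultural \<alpha> \<delta> X d s ya ym LA LM pr i = 0) \<and>
     excess_manufactured \<alpha> \<delta> X d s ya ym LA LM pr = 0"

(* LA is not assumed bounded above, so for the potential to be real-valued the integrability
   of this integrand over X has to be assumed separately. *)
definition potential ::
  "real \<Rightarrow> real \<Rightarrow> (real^2) set \<Rightarrow> (real^2 \<Rightarrow> real^2 \<Rightarrow> real) \<Rightarrow> ('n::finite \<Rightarrow> real^2)
    \<Rightarrow> (real^2 \<Rightarrow> real) \<Rightarrow> ('n \<Rightarrow> real) \<Rightarrow> (real^2 \<Rightarrow> real) \<Rightarrow> ('n \<Rightarrow> real)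
    \<Rightarrow> (real^'n) \<times> real \<Rightarrow> real" where
  "potential \<alpha> \<delta> X d s ya ym LA LM pr =
     - (\<Sum>i\<in>UNIV. utility \<alpha> (snd pr) (fst pr $ i) (urban_income ym pr i) * LM i)
     - (LINT x : X | lebesgue. rural_utility \<alpha> \<delta> d s ya x pr * LA x)"

end

theory Submission
  imports Defs
begin

text \<open>At prices \<open>(p, q)\<close> the utility from city \<open>i\<close> is its income times a price index
  \<open>B i\<close>, so a farmer at \<open>x\<close> attains the maximum over \<open>i\<close> of \<open>B i * p i\<close> times a positive
  function of \<open>x\<close>, and \<open>B i * p i = exp (\<delta> * \<lambda> i)\<close>: the Voronoi cell of \<open>i\<close> is where \<open>i\<close> is the
  strict maximiser.  Admissibility makes ties a null set, so by the envelope theorem the integral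
  is differentiable and only the maximising branch contributes.  With Roy's identity for \<open>B i\<close>,
  the gradient has components \<open>B i * Z i\<close> and \<open>\<Sum>i. B i * W i\<close>, where \<open>W i\<close> is the excess demand for
  the manufactured good in city \<open>i\<close>.  The weights \<open>B i\<close> in the sum differ between the cities, but the
  city-wise Walras law \<open>p i * Z i + q * W i = 0\<close> makes all \<open>W i\<close> vanish once all \<open>Z i\<close> do.\<close>

section \<open>Maxima of finite families of functions\<close>

text \<open>Each \<open>a i\<close> exceeds \<open>b i\<close>, hence the maximum of
  \<open>b\<close>, by at most the whole sum; exchanging \<open>a\<close> and \<open>b\<close> gives
  the other sign. With \<open>b = 0\<close> this yields integrability of a maximum, and in the
  envelope theorem it yields the majorant.\<close>

lemma abs_Max_diff_le:
  fixes a b :: "'i::finite \<Rightarrow> real"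
  shows "\<bar>Max (range a) - Max (range b)\<bar> \<le> (\<Sum>i\<in>UNIV. \<bar>a i - b i\<bar>)"
proof -
  have le: "Max (range a) \<le> Max (range b) + (\<Sum>i\<in>UNIV. \<bar>a i - b i\<bar>)"
    for a b :: "'i \<Rightarrow> real"
  proof -
    have "a i \<le> Max (range b) + (\<Sum>i\<in>UNIV. \<bar>a i - b i\<bar>)" for i
    proof -
      have "b i \<le> Max (range b)" by simp
      moreover have "\<bar>a i - b i\<bar> \<le> (\<Sum>i\<in>UNIV. \<bar>a i - b i\<bar>)"
        by (rule member_le_sum) auto
      ultimately show ?thesis by linarith
    qed
    then show ?thesis by simp
  qed
  from le[of a b] le[of b a] show ?thesis
    by (simp only: abs_minus_commute[of "b _"] abs_le_iff) linarith
qed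

lemma borel_measurable_Max_range [measurable]:
  fixes f :: "'i::finite \<Rightarrow> 'a \<Rightarrow> real"
  assumes "\<And>i. f i \<in> borel_measurable M"
  shows "(\<lambda>x. Max (range (\<lambda>i. f i x))) \<in> borel_measurable M"
  using borel_measurable_Max[of UNIV f M] assms by simp

lemma integrable_Max_range:
  fixes f :: "'i::finite \<Rightarrow> 'a \<Rightarrow> real"
  assumes "\<And>i. integrable M (f i)"
  shows "integrable M (\<lambda>x. Max (range (\<lambda>i. f i x)))"
proof (rule Bochner_Integration.integrable_bound)
  show "integrable M (\<lambda>x. \<Sum>i\<in>UNIV. \<bar>f i x\<bar>)"
    using assms by simp
  show "(\<lambda>x. Max (range (\<lambda>i. f i x))) \<in> borel_measurable M"
    by (intro borel_measurable_Max_range borel_measurable_integrable assms)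
  show "AE x in M. norm (Max (range (\<lambda>i. f i x))) \<le> norm (\<Sum>i\<in>UNIV. \<bar>f i x\<bar>)"
  proof (rule AE_I2)
    fix x
    have "(\<lambda>_::'i. 0::real) ` UNIV = {0}" by auto
    then show "norm (Max (range (\<lambda>i. f i x))) \<le> norm (\<Sum>i\<in>UNIV. \<bar>f i x\<bar>)"
      using abs_Max_diff_le[of "\<lambda>i. f i x" "\<lambda>_. 0"] by simp
  qed
qed

section \<open>Regions of strict maximality and the envelope theorem\<close>

text \<open>The inequality is strict, as in the Voronoi cells \<open>Omega\<close>: the regions are
  pairwise disjoint and points with a tied maximum lie in none of them.\<close>

definition argmax_region :: "'a measure \<Rightarrow> ('i \<Rightarrow> 'a \<Rightarrow> real) \<Rightarrow> 'i \<Rightarrow> 'a set" where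
  "argmax_region M f i = {x \<in> space M. \<forall>j. j \<noteq> i \<longrightarrow> f j x < f i x}"

lemma sets_argmax_region [measurable]:
  fixes f :: "'i::finite \<Rightarrow> 'a \<Rightarrow> real"
  assumes [measurable]: "\<And>i. f i \<in> borel_measurable M"
  shows "argmax_region M f i \<in> sets M"
proof -
  have "argmax_region M f i = {x \<in> space M. \<forall>j\<in>UNIV - {i}. f j x < f i x}"
    unfolding argmax_region_def by auto
  also have "\<dots> \<in> sets M" by measurable
  finally show ?thesis .
qed

lemma argmax_region_Max:
  fixes f :: "'i::finite \<Rightarrow> 'a \<Rightarrow> real"
  assumes "x \<in> argmax_region M f i"
  shows "Max (range (\<lambda>i. f i x)) = f i x"
  using assms by (intro Max_eqI) (force simp: argmax_region_def less_imp_le)+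

lemma sum_indicator_argmax_region:
  fixes f c :: "'i::finite \<Rightarrow> 'a \<Rightarrow> real"
  assumes "x \<in> argmax_region M f i"
  shows "(\<Sum>j\<in>UNIV. indicator (argmax_region M f j) x * c j x) = c i x"
proof -
  have "x \<notin> argmax_region M f j" if "j \<noteq> i" for j
    using assms that less_asym unfolding argmax_region_def by blast
  then have "(\<Sum>j\<in>UNIV. indicator (argmax_region M f j) x * c j x)
      = (\<Sum>j\<in>UNIV. if j = i then c j x else 0)"
    using assms by (intro sum.cong) auto
  then show ?thesis by simp
qed

text \<open>Envelope theorem: only the maximising branch contributes to the derivative.  Where the
  maximiser is unique it stays the maximiser nearby, so the linearisation error there is
  eventually exactly zero, and dominated convergence applies.\<close>

lemma has_derivative_integral_Max:
  fixes h :: "'i::finite \<Rightarrow> 'a \<Rightarrow> real" and u :: "real^'i"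
  assumes int: "\<And>i. integrable M (h i)"
    and no_tie: "\<And>i j. i \<noteq> j \<Longrightarrow> AE x in M. u $ i * h i x \<noteq> u $ j * h j x"
  shows "((\<lambda>v. LINT x|M. Max (range (\<lambda>i. v $ i * h i x))) has_derivative
    (\<lambda>k. \<Sum>i\<in>UNIV. k $ i *
       (LINT x|M. indicator (argmax_region M (\<lambda>i x. u $ i * h i x) i) x * h i x))) (at u)"
proof -
  define D where "D = argmax_region M (\<lambda>i x. u $ i * h i x)"
  define m where "m v x = Max (range (\<lambda>i. v $ i * h i x))" for v :: "real^'i" and x
  \<comment> \<open>The candidate linearisation of \<open>m\<close> at \<open>u\<close>: on
    \<open>D i\<close> it reduces to \<open>k $ i * h i x\<close>, since the regions are
    disjoint.\<close>
  define l where "l k x = (\<Sum>i\<in>UNIV. indicator (D i) x * (k $ i * h i x))" for k :: "real^'i" and x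
  define H where "H x = (\<Sum>i\<in>UNIV. \<bar>h i x\<bar>)" for x
  have meas[measurable]: "h i \<in> borel_measurable M" for i
    using int by auto
  have Dsets[measurable]: "D i \<in> sets M" for i
    unfolding D_def by (rule sets_argmax_region) measurable
  have int_m: "integrable M (m v)" for v
    unfolding m_def using int by (intro integrable_Max_range) auto
  have int_ih: "integrable M (\<lambda>x. indicator (D i) x * h i x)" for i
    using integrable_mult_indicator[OF Dsets int, of i] by simp
  have l_alt: "l k x = (\<Sum>i\<in>UNIV. k $ i * (indicator (D i) x * h i x))" for k x
    unfolding l_def by (simp add: mult_ac)
  have int_l: "integrable M (l k)" for k
    unfolding l_alt[abs_def] using int_ih by auto
  have integral_l: "(\<Sum>i\<in>UNIV. k $ i * (LINT x|M. indicator (D i) x * h i x)) = integral\<^sup>L M (l k)" for k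
    unfolding l_alt[abs_def] using int_ih by simp
  have int_H: "integrable M H"
    unfolding H_def using int by auto
  have AE_D: "AE x in M. \<exists>i. x \<in> D i"
  proof -
    have "AE x in M. \<forall>i j. i \<noteq> j \<longrightarrow> u $ i * h i x \<noteq> u $ j * h j x"
      using no_tie by (simp add: AE_all_countable)
    then show ?thesis
    proof (rule AE_mp, intro AE_I2 impI)
      fix x assume x: "x \<in> space M" and ne: "\<forall>i j. i \<noteq> j \<longrightarrow> u $ i * h i x \<noteq> u $ j * h j x"
      have "Max (range (\<lambda>i. u $ i * h i x)) \<in> range (\<lambda>i. u $ i * h i x)"
        by (intro Max_in) auto
      then obtain i where i: "Max (range (\<lambda>i. u $ i * h i x)) = u $ i * h i x" by blast
      have "u $ j * h j x < u $ i * h i x" if "j \<noteq> i" for j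
      proof -
        have "u $ j * h j x \<le> u $ i * h i x" unfolding i[symmetric] by simp
        then show ?thesis using ne that by (metis order_less_le)
      qed
      with x show "\<exists>i. x \<in> D i" unfolding D_def argmax_region_def by auto
    qed
  qed
  have sum_le: "(\<Sum>i\<in>UNIV. \<bar>k $ i * h i x\<bar>) \<le> norm k * H x" for k :: "real^'i" and x
    unfolding H_def sum_distrib_left abs_mult
    by (intro sum_mono mult_right_mono component_le_norm_cart) auto
  \<comment> \<open>The increment of the maximum and its linearisation are each at most
    \<open>norm k * H x\<close>, whence the factor 2. After division by \<open>norm k\<close> the
    majorant \<open>2 * H x\<close> is integrable and independent of \<open>k\<close>.\<close>
  have bound: "\<bar>m (u + k) x - m u x - l k x\<bar> \<le> 2 * (norm k * H x)" for k x
  proof -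
    have "\<bar>m (u + k) x - m u x\<bar> \<le> (\<Sum>i\<in>UNIV. \<bar>k $ i * h i x\<bar>)"
      unfolding m_def using abs_Max_diff_le[of "\<lambda>i. (u + k) $ i * h i x" "\<lambda>i. u $ i * h i x"]
      by (simp add: algebra_simps)
    moreover have "\<bar>l k x\<bar> \<le> (\<Sum>i\<in>UNIV. \<bar>k $ i * h i x\<bar>)"
      unfolding l_def by (intro order_trans[OF sum_abs] sum_mono) (auto simp: indicator_def)
    ultimately show ?thesis using sum_le[of k x] by linarith
  qed
  have "((\<lambda>v. integral\<^sup>L M (m v)) has_derivative (\<lambda>k. integral\<^sup>L M (l k))) (at u)"
    unfolding has_derivative_at
  proof
    show "bounded_linear (\<lambda>k. integral\<^sup>L M (l k))"
      unfolding integral_l[symmetric]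
      by (intro bounded_linear_sum bounded_linear_mult_const bounded_linear_vec_nth)
    show "(\<lambda>k. norm (integral\<^sup>L M (m (u + k)) - integral\<^sup>L M (m u) - integral\<^sup>L M (l k)) / norm k) \<midarrow>0\<rightarrow> 0"
      \<comment> \<open>Dominated convergence concerns sequences, so the limit is tested along an
        arbitrary sequence of nonzero increments tending to 0.\<close>
      unfolding tendsto_at_iff_sequentially comp_def
    proof (intro allI impI)
      fix k :: "nat \<Rightarrow> real^'i"
      assume k_ne: "\<forall>n. k n \<in> UNIV - {0}" and k_lim: "k \<longlonglongrightarrow> 0"
      define e where "e n x = (m (u + k n) x - m u x - l (k n) x) / norm (k n)" for n x
      have e_int: "integral\<^sup>L M (e n) =
          (integral\<^sup>L M (m (u + k n)) - integral\<^sup>L M (m u) - integral\<^sup>L M (l (k n))) / norm (k n)" for n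
        unfolding e_def using int_m int_l by simp
      have "(\<lambda>n. integral\<^sup>L M (e n)) \<longlonglongrightarrow> integral\<^sup>L M (\<lambda>x. 0)"
      proof (rule integral_dominated_convergence)
        show "e n \<in> borel_measurable M" for n
          unfolding e_def using int_m int_l
          by (intro borel_measurable_divide borel_measurable_diff borel_measurable_integrable) auto
        show "integrable M (\<lambda>x. 2 * H x)" using int_H by simp
        show "AE x in M. norm (e n x) \<le> 2 * H x" for n
          using bound[of "k n"] k_ne
          by (intro AE_I2) (simp add: e_def divide_le_eq mult_ac)
        show "AE x in M. (\<lambda>n. e n x) \<longlonglongrightarrow> 0"
          using AE_D
        proof (rule AE_mp, intro AE_I2 impI)
          fix x assume x: "x \<in> space M" and "\<exists>i. x \<in> D i"
          then obtain i where i: "x \<in> D i" by blast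
          have ev: "eventually (\<lambda>n. (u + k n) $ j * h j x < (u + k n) $ i * h i x) sequentially"
            if "j \<noteq> i" for j
          proof -
            have lim: "(\<lambda>n. (u + k n) $ j * h j x) \<longlonglongrightarrow> u $ j * h j x" for j
              using tendsto_vec_nth[OF tendsto_add[OF tendsto_const k_lim], of u j]
              by (intro tendsto_mult_right) simp
            have "u $ j * h j x - u $ i * h i x < 0"
              using i that by (simp add: D_def argmax_region_def)
            from order_tendstoD(2)[OF tendsto_diff[OF lim[of j] lim[of i]] this]
            show ?thesis by simp
          qed
          have "eventually (\<lambda>n. \<forall>j\<in>UNIV - {i}. (u + k n) $ j * h j x < (u + k n) $ i * h i x) sequentially"
            using ev by (intro eventually_ball_finite) auto
          then have "eventually (\<lambda>n. e n x = 0) sequentially"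
          proof eventually_elim
            case (elim n)
            then have "x \<in> argmax_region M (\<lambda>i x. (u + k n) $ i * h i x) i"
              using x unfolding argmax_region_def by auto
            then have "m (u + k n) x = (u + k n) $ i * h i x"
              unfolding m_def by (rule argmax_region_Max)
            moreover have "m u x = u $ i * h i x"
              using argmax_region_Max[OF i[unfolded D_def]] unfolding m_def .
            moreover have "l (k n) x = k n $ i * h i x"
              using sum_indicator_argmax_region[OF i[unfolded D_def], of "\<lambda>i x. k n $ i * h i x"]
              unfolding l_def D_def .
            ultimately show ?case by (simp add: e_def algebra_simps)
          qed
          then show "(\<lambda>n. e n x) \<longlonglongrightarrow> 0" by (rule tendsto_eventually)
        qed
      qed simp
      then have "(\<lambda>n. \<bar>integral\<^sup>L M (e n)\<bar>) \<longlonglongrightarrow> 0"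
        by (simp add: tendsto_rabs_zero)
      then show "(\<lambda>n. norm (integral\<^sup>L M (m (u + k n)) - integral\<^sup>L M (m u) - integral\<^sup>L M (l (k n)))
          / norm (k n)) \<longlonglongrightarrow> 0"
        unfolding e_int by (simp add: abs_divide)
    qed
  qed
  then show ?thesis
    unfolding integral_l[symmetric] unfolding m_def D_def .
qed

section \<open>Ties between cities form a null set\<close>

text \<open>The level set at \<gamma> is contained in every sublevel set with a larger threshold but
  is disjoint from the one at \<gamma>. Its measure is therefore at most the increase of the
  sublevel measure to the right of \<gamma>, which tends to 0 by continuity.\<close>

lemma admissible_level_set_null:
  assumes adm: "admissible S d" and st: "s \<in> S" "t \<in> S" "s \<noteq> t"
    and cont: "continuous_on UNIV (d s)" "continuous_on UNIV (d t)"
    and C: "open C" "bounded C"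
  shows "C \<inter> {x. d s x - d t x = \<gamma>} \<in> null_sets lebesgue"
proof -
  define g where "g \<gamma> = measure lebesgue (C \<inter> R d \<gamma> s t)" for \<gamma>
  obtain m M where mM: "m < M" and contg: "continuous_on {m..M} g"
    and lo: "\<And>\<gamma>. \<gamma> \<le> m \<Longrightarrow> C \<inter> R d \<gamma> s t = {}"
    and hi: "\<And>\<gamma>. \<gamma> \<ge> M \<Longrightarrow> C \<subseteq> R d \<gamma> s t"
    using adm st C unfolding admissible_def g_def by metis
  define E where "E = C \<inter> {x. d s x - d t x = \<gamma>}"
  have contdiff: "continuous_on UNIV (\<lambda>x. d s x - d t x)"
    by (intro continuous_on_diff cont)
  have openR: "open (C \<inter> R d \<gamma>' s t)" for \<gamma>'
    unfolding R_def by (intro open_Int C open_Collect_less contdiff continuous_on_const)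
  have lmR: "C \<inter> R d \<gamma>' s t \<in> lmeasurable" for \<gamma>'
    using openR C(2) bounded_Int lmeasurable_open by blast
  have "closed {x. d s x - d t x = \<gamma>}"
    by (intro closed_Collect_eq contdiff continuous_on_const)
  then have Ebor: "E \<in> sets borel"
    unfolding E_def using C by (intro sets.Int) auto
  have lmE: "E \<in> lmeasurable"
    using Ebor C(2) by (intro bounded_set_imp_lmeasurable) (auto simp: E_def intro: bounded_subset)
  have "measure lebesgue E \<le> 0"
  \<comment> \<open>Below \<open>m\<close> and from \<open>M\<close> on the level set is empty. The
    value \<open>m\<close> itself may be attained, so it belongs to the other case, where right
    continuity is available because \<gamma> lies in [m, M).\<close>
  proof (cases "\<gamma> < m \<or> M \<le> \<gamma>")
    case True
    then have "E = {}"
    proof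
      assume "\<gamma> < m"
      then show ?thesis using lo[of m] unfolding E_def R_def by auto
    next
      assume "M \<le> \<gamma>"
      then show ?thesis using hi[of \<gamma>] unfolding E_def R_def by auto
    qed
    then show ?thesis by simp
  next
    case False
    have le: "measure lebesgue E \<le> g \<gamma>' - g \<gamma>" if "\<gamma> < \<gamma>'" for \<gamma>'
    proof -
      have "C \<inter> R d \<gamma> s t - E = C \<inter> R d \<gamma> s t"
        unfolding E_def R_def by auto
      then have "measure lebesgue E + g \<gamma> = measure lebesgue (E \<union> (C \<inter> R d \<gamma> s t))"
        unfolding g_def using measure_Un2[OF lmE lmR[of \<gamma>]] by simp
      also have "\<dots> \<le> g \<gamma>'"
        unfolding g_def using lmE lmR that
        by (intro measure_mono_fmeasurable) (auto simp: E_def R_def)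
      finally show ?thesis by simp
    qed
    have "(g \<longlongrightarrow> g \<gamma>) (at \<gamma> within {m..M})"
      using contg False by (auto simp: continuous_on_def)
    \<comment> \<open>Restricting to thresholds in the open interval from \<gamma> to
      \<open>M\<close> makes the estimate \<open>le\<close> applicable; as \<gamma> <
      \<open>M\<close>, the filter is nontrivial.\<close>
    then have "(g \<longlongrightarrow> g \<gamma>) (at \<gamma> within {\<gamma><..<M})"
      using False by (elim tendsto_within_subset) auto
    then have "((\<lambda>\<gamma>'. g \<gamma>' - g \<gamma>) \<longlongrightarrow> g \<gamma> - g \<gamma>) (at \<gamma> within {\<gamma><..<M})"
      by (intro tendsto_diff tendsto_const)
    moreover have "at \<gamma> within {\<gamma><..<M} \<noteq> bot"
      using False by (simp add: at_within_eq_bot_iff trivial_limit_within islimpt_greaterThanLessThan1)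
    moreover have "eventually (\<lambda>\<gamma>'. measure lebesgue E \<le> g \<gamma>' - g \<gamma>) (at \<gamma> within {\<gamma><..<M})"
      using le by (auto simp: eventually_at_filter)
    ultimately show ?thesis
      using tendsto_lowerbound by fastforce
  qed
  then have "measure lebesgue E = 0" using measure_nonneg[of lebesgue E] by linarith
  then show ?thesis
    using lmE unfolding E_def[symmetric] negligible_iff_null_sets[symmetric] negligible_iff_measure by simp
qed

lemma has_derivative_vec_lambda:
  fixes f :: "'a::real_normed_vector \<Rightarrow> 'i::finite \<Rightarrow> real"
  assumes "\<And>i. ((\<lambda>x. f x i) has_derivative (\<lambda>h. f' h i)) (at x within S)"
  shows "((\<lambda>x. \<chi> i. f x i) has_derivative (\<lambda>h. \<chi> i. f' h i)) (at x within S)"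
  unfolding has_derivative_componentwise_within[of "\<lambda>x. \<chi> i. f x i"]
  using assms by (auto simp: Basis_vec_def inner_axis)

section \<open>The price index, Roy's identity and the Voronoi weights\<close>

text \<open>For positive prices and nonzero \<alpha> < 1 this is the marginal utility of income,
  that is, the reciprocal of the usual CES cost-of-living index.\<close>

definition price_index :: "real \<Rightarrow> real \<Rightarrow> real \<Rightarrow> real" where
  "price_index \<alpha> q p =
     (q powr (- (\<alpha> / (1 - \<alpha>))) + p powr (- (\<alpha> / (1 - \<alpha>)))) powr ((1 - \<alpha>) / \<alpha>)"

lemma utility_eq: "utility \<alpha> q p w = price_index \<alpha> q p * w"
  by (simp add: utility_def price_index_def)

lemma demand_m_eq: "demand_m \<alpha> q p w = demand_m \<alpha> q p 1 * w"
  by (simp add: demand_m_def)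

lemma demand_a_eq: "demand_a \<alpha> q p w = demand_a \<alpha> q p 1 * w"
  by (simp add: demand_a_def)

lemma price_index_pos: "0 < q \<Longrightarrow> 0 < p \<Longrightarrow> 0 < price_index \<alpha> q p"
  using add_pos_pos[of "q powr (- (\<alpha> / (1 - \<alpha>)))" "p powr (- (\<alpha> / (1 - \<alpha>)))"]
  by (simp add: price_index_def)

lemma budget_identity:
  assumes "0 < q" "0 < p"
  shows "p * demand_a \<alpha> q p w + q * demand_m \<alpha> q p w = w"
proof -
  have "p powr (\<alpha> / (1 - \<alpha>)) + q powr (\<alpha> / (1 - \<alpha>)) > 0"
    using assms by (simp add: add_pos_pos)
  then show ?thesis
    using assms by (simp add: demand_a_def demand_m_def divide_simps) (simp add: algebra_simps)
qed

text \<open>Roy's identity at unit income: the logarithmic derivative of the index in each price is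
  minus the demand for that good. Allowing differentiable functions \<open>P\<close> and
  \<open>Q\<close> lets it be applied directly to coordinates of the price vector.\<close>

lemma has_derivative_price_index:
  fixes P Q :: "'a::real_normed_vector \<Rightarrow> real"
  assumes P: "(P has_derivative P') (at z)" and Q: "(Q has_derivative Q') (at z)"
    and pos: "0 < P z" "0 < Q z" and \<alpha>: "\<alpha> \<noteq> 0" "\<alpha> < 1"
  shows "((\<lambda>z. price_index \<alpha> (Q z) (P z)) has_derivative
    (\<lambda>h. - price_index \<alpha> (Q z) (P z) *
       (demand_m \<alpha> (Q z) (P z) 1 * Q' h + demand_a \<alpha> (Q z) (P z) 1 * P' h))) (at z)"
proof -
  define b where "b = \<alpha> / (1 - \<alpha>)"
  have b: "b \<noteq> 0" "(1 - \<alpha>) / \<alpha> = 1 / b" using \<alpha> by (auto simp: b_def)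
  define A where "A z = Q z powr (-b) + P z powr (-b)" for z
  define A' where "A' h = - b * (Q z powr (-b) * Q' h / Q z + P z powr (-b) * P' h / P z)" for h
  have Apos: "A z > 0" unfolding A_def using pos by (simp add: add_pos_pos)
  have dA: "(A has_derivative A') (at z)"
    unfolding A_def[abs_def] A'_def[abs_def]
    by (rule has_derivative_eq_rhs, (rule derivative_intros P Q pos UNIV_I)+)
      (auto simp: algebra_simps)
  have "((\<lambda>z. A z powr (1 / b)) has_derivative (\<lambda>h. A z powr (1 / b) * (A' h / b / A z))) (at z)"
    by (rule has_derivative_eq_rhs, (rule derivative_intros dA Apos UNIV_I)+)
      (auto simp: algebra_simps)
  moreover have eq: "A' h / b / A z =
    - (demand_m \<alpha> (Q z) (P z) 1 * Q' h + demand_a \<alpha> (Q z) (P z) 1 * P' h)" for h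
  proof -
    \<comment> \<open>Multiplying numerator and denominator by the product of both prices to the
      power \<open>b\<close> turns these quotients into the expenditure shares of the two
      goods.\<close>
    have m: "Q z powr (-b) / A z = demand_m \<alpha> (Q z) (P z) 1 * Q z"
      and a: "P z powr (-b) / A z = demand_a \<alpha> (Q z) (P z) 1 * P z"
      unfolding A_def demand_m_def demand_a_def b_def[symmetric] using pos
      by (simp_all add: powr_minus divide_simps add_pos_pos less_imp_neq[symmetric])
    have "A' h / b / A z = - ((Q z powr (-b) / A z) * Q' h / Q z + (P z powr (-b) / A z) * P' h / P z)"
      unfolding A'_def using b Apos by (simp add: field_simps)
    then show ?thesis unfolding m a using pos by simp
  qed
  ultimately have "((\<lambda>z. A z powr (1 / b)) has_derivative
      (\<lambda>h. - (A z powr (1 / b)) * (demand_m \<alpha> (Q z) (P z) 1 * Q' h + demand_a \<alpha> (Q z) (P z) 1 * P' h))) (at z)"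
    unfolding eq by (simp only: mult_minus_left mult_minus_right)
  then show ?thesis
    unfolding A_def price_index_def b_def[symmetric] b(2) .
qed

text \<open>With b = \<open>\<alpha> / (1 - \<alpha>)\<close>, factoring \<open>p powr b\<close> out
  of \<open>1 + (p / q) powr b\<close> leaves the base of the price index, and the power 1/b turns
  the factor into \<open>p\<close>. Comparing utilities thus becomes comparing distances shifted by
  the weights.\<close>

lemma exp_voronoi_weights:
  assumes pos: "positive_prices pr" and "\<alpha> \<noteq> 0" "\<alpha> < 1" "0 < \<delta>"
  shows "exp (\<delta> * voronoi_weights \<alpha> \<delta> pr $ i) = price_index \<alpha> (snd pr) (fst pr $ i) * fst pr $ i"
proof -
  define b where "b = \<alpha> / (1 - \<alpha>)"
  define p q where "p = fst pr $ i" and "q = snd pr"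
  have p: "p > 0" "q > 0" using pos by (auto simp: positive_prices_def p_def q_def)
  have b: "b \<noteq> 0" "(1 - \<alpha>) / \<alpha> = 1 / b" using assms by (auto simp: b_def)
  have "1 + (p / q) powr b > 0" using p by (simp add: add_pos_nonneg)
  then have "exp (\<delta> * voronoi_weights \<alpha> \<delta> pr $ i) = (1 + (p / q) powr b) powr (1 / b)"
    using assms unfolding voronoi_weights_def b(2)
    by (simp add: powr_def b_def p_def q_def)
  also have "1 + (p / q) powr b = (q powr (-b) + p powr (-b)) * p powr b"
    using p by (simp add: powr_minus powr_divide field_simps)
  also have "\<dots> powr (1 / b) = (q powr (-b) + p powr (-b)) powr (1 / b) * p"
    using p b by (simp add: powr_mult powr_powr)
  finally show ?thesis
    unfolding price_index_def b_def[symmetric] b(2) p_def q_def .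
qed

section \<open>Equilibria as critical points of the potential\<close>

theorem propositionA1:
  fixes X :: "(real^2) set"
    and s :: "'n::finite \<Rightarrow> real^2"
    and d :: "real^2 \<Rightarrow> real^2 \<Rightarrow> real"
    and ya LA :: "real^2 \<Rightarrow> real"
    and ym LM :: "'n \<Rightarrow> real"
    and ya_min ya_max LA_min \<alpha> \<delta> :: real
    and pr :: "(real^'n) \<times> real"
  assumes "open X" "bounded X" "connected X" "lipschitz_boundary X"
    and "inj s" "range s \<subseteq> X"
    and "\<And>t. t \<in> range s \<Longrightarrow> continuous_on UNIV (d t)"
    and "\<And>t x. t \<in> range s \<Longrightarrow> 0 \<le> d t x"
    and "admissible (range s) d"
    and "continuous_on X ya" "0 < ya_min"
    and "\<And>x. x \<in> X \<Longrightarrow> ya_min \<le> ya x \<and> ya x \<le> ya_max"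
    and "\<And>i. 0 < ym i" "\<And>i. 0 < LM i"
    and "continuous_on X LA" "0 < LA_min" "\<And>x. x \<in> X \<Longrightarrow> LA_min \<le> LA x"
    and "\<alpha> < 1" "\<alpha> \<noteq> 0" "0 < \<delta>"
    and F_real_valued: "\<And>pr' :: (real^'n) \<times> real. positive_prices pr' \<Longrightarrow>
      set_integrable lebesgue X (\<lambda>x. rural_utility \<alpha> \<delta> d s ya x pr' * LA x)"
    and "positive_prices pr"
  shows "\<exists>gradF. (GDERIV (potential \<alpha> \<delta> X d s ya ym LA LM) pr :> gradF) \<and>
    (equilibrium \<alpha> \<delta> X d s ya ym LA LM pr \<longleftrightarrow> gradF = 0)"
proof -
  note X = \<open>open X\<close> \<open>bounded X\<close>
  have Xsets [simp]: "X \<in> sets lebesgue" using X by simp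
  note \<alpha> = \<open>\<alpha> \<noteq> 0\<close> \<open>\<alpha> < 1\<close> and \<delta> = \<open>0 < \<delta>\<close>
  have d_cont: "continuous_on UNIV (d (s i))" for i using assms(7) by blast
  have ya_pos: "0 < ya x" if "x \<in> X" for x
    using assms(12)[OF that] \<open>0 < ya_min\<close> by linarith
  have LA_pos: "0 < LA x" if "x \<in> X" for x
    using assms(17)[OF that] \<open>0 < LA_min\<close> by linarith
  define q p where "q = snd pr" and "p i = fst pr $ i" for i
  have q: "0 < q" and p: "0 < p i" for i
    using \<open>positive_prices pr\<close> by (auto simp: positive_prices_def q_def p_def)
  define B where "B i = price_index \<alpha> q (p i)" for i
  have B: "0 < B i" for i unfolding B_def using q p by (rule price_index_pos)
  \<comment> \<open>The envelope theorem integrates over a whole measure space; restricting Lebesgue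
    measure to \<open>X\<close> also places the argmax regions inside \<open>X\<close>.\<close>
  define N where "N = lebesgue_on X"
  have spaceN: "space N = X" by (simp add: N_def space_restrict_space)
  have LINT_N: "(LINT x:X|lebesgue. f x) = integral\<^sup>L N f" for f :: "real^2 \<Rightarrow> real"
    by (simp add: N_def integral_restrict_space set_lebesgue_integral_def)

  \<comment> \<open>Place and prices separate: \<open>h\<close> carries all dependence on
    \<open>x\<close>, \<open>U\<close> all dependence on prices. The rural integral becomes a
    function of the vector \<open>U pr\<close> and can be differentiated by the chain rule.\<close>
  define h where "h i x = ya x / shipping \<delta> d x (s i) * LA x" for i x
  have h_pos: "0 < h i x" if "x \<in> X" for i x
    unfolding h_def shipping_def using ya_pos[OF that] LA_pos[OF that] by simp
  have "continuous_on X (h i)" for i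
    unfolding h_def shipping_def
    by (intro continuous_intros assms continuous_on_subset[OF d_cont]) auto
  then have h_meas: "h i \<in> borel_measurable N" for i
    unfolding N_def by (intro continuous_imp_measurable_on_sets_lebesgue) simp_all
  define U where "U pr = (\<chi> i. price_index \<alpha> (snd pr) (fst pr $ i) * fst pr $ i)"
    for pr :: "(real^'n) \<times> real"
  define u where "u = U pr"
  have u_nth: "u $ i = B i * p i" for i by (simp add: u_def U_def B_def p_def q_def)
  have u_pos: "0 < u $ i" for i unfolding u_nth using B p by simp

  have rural: "rural_utility \<alpha> \<delta> d s ya x pr' * LA x = Max (range (\<lambda>i. U pr' $ i * h i x))"
    if "x \<in> X" for x pr'
  proof -
    have "mono (\<lambda>y. y * LA x)"
      using LA_pos[OF that] by (intro monoI mult_right_mono) auto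
    from mono_Max_commute[OF this] show ?thesis
      unfolding rural_utility_def
      by (simp add: image_image utility_eq rural_income_def U_def h_def mult.assoc)
  qed
  \<comment> \<open>The hypothesis gives integrability of the maximum only. The branches are
    positive on \<open>X\<close> and lie below the maximum, so dividing it by \<open>u $ i\<close>
    dominates \<open>h i\<close>.\<close>
  have h_int: "integrable N (h i)" for i
  proof (rule Bochner_Integration.integrable_bound)
    have "integrable N (\<lambda>x. rural_utility \<alpha> \<delta> d s ya x pr * LA x)"
      using F_real_valued[OF \<open>positive_prices pr\<close>]
      by (simp add: N_def set_integrable_def integrable_restrict_space)
    then have "integrable N (\<lambda>x. Max (range (\<lambda>i. u $ i * h i x)))"
      by (subst (asm) Bochner_Integration.integrable_cong[OF refl rural])
        (auto simp: spaceN u_def)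
    then show "integrable N (\<lambda>x. Max (range (\<lambda>i. u $ i * h i x)) / u $ i)" by simp
    have "u $ i * h i x \<le> Max (range (\<lambda>i. u $ i * h i x))" for x by simp
    then have "h i x \<le> Max (range (\<lambda>i. u $ i * h i x)) / u $ i" for x
      using u_pos[of i] by (simp add: pos_le_divide_eq mult.commute)
    then show "AE x in N. norm (h i x) \<le> norm (Max (range (\<lambda>i. u $ i * h i x)) / u $ i)"
      using h_pos by (intro AE_I2) (smt (verit) real_norm_def spaceN)
  qed (rule h_meas)

  define lam where "lam = voronoi_weights \<alpha> \<delta> pr"
  \<comment> \<open>The factor \<open>ya x * LA x\<close> is common to all branches and positive on
    \<open>X\<close>. Hence branches are ordered as the numbers \<open>lam $ i - d (s i) x\<close>,
    which identifies ties with level sets and \<open>Omega\<close> with the argmax regions.\<close>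
  have branch: "u $ i * h i x = exp (\<delta> * (lam $ i - d (s i) x)) * (ya x * LA x)" for i x
    using exp_voronoi_weights[OF \<open>positive_prices pr\<close> \<alpha> \<delta>, of i]
    by (simp add: u_def U_def lam_def h_def shipping_def right_diff_distrib exp_diff)
  have no_tie: "AE x in N. u $ i * h i x \<noteq> u $ j * h j x" if "i \<noteq> j" for i j
  proof -
    have "X \<inter> {x. d (s i) x - d (s j) x = lam $ i - lam $ j} \<in> null_sets lebesgue"
      using that \<open>inj s\<close>
      by (intro admissible_level_set_null[OF \<open>admissible (range s) d\<close>] X d_cont) (auto dest: injD)
    then have "AE x in lebesgue. x \<in> X \<longrightarrow> d (s i) x - d (s j) x \<noteq> lam $ i - lam $ j"
      by (intro AE_I') auto
    then have "AE x in lebesgue. x \<in> X \<longrightarrow> u $ i * h i x \<noteq> u $ j * h j x"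
    proof (rule AE_mp, intro AE_I2 impI)
      fix x assume "x \<in> X \<longrightarrow> d (s i) x - d (s j) x \<noteq> lam $ i - lam $ j" "x \<in> X"
      then show "u $ i * h i x \<noteq> u $ j * h j x"
        using ya_pos[of x] LA_pos[of x] \<delta> by (auto simp: branch)
    qed
    then show ?thesis unfolding N_def by (subst AE_restrict_space_iff) auto
  qed
  have Omega_eq: "Omega X d s lam i = argmax_region N (\<lambda>i x. u $ i * h i x) i" for i
  proof -
    have "u $ j * h j x < u $ i * h i x \<longleftrightarrow> d (s i) x - d (s j) x < lam $ i - lam $ j"
      if "x \<in> X" for x j
      using ya_pos[OF that] LA_pos[OF that] \<delta> by (auto simp: branch)
    then show ?thesis
      unfolding Omega_def argmax_region_def R_def spaceN by auto
  qed
  have Omega_sub: "Omega X d s lam i \<subseteq> X" for i by (auto simp: Omega_def)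
  have Omega_sets: "Omega X d s lam i \<in> sets lebesgue" for i
  proof -
    have "Omega X d s lam i \<in> sets N"
      unfolding Omega_eq by (intro sets_argmax_region borel_measurable_times h_meas) simp
    then show ?thesis by (simp add: N_def sets_restrict_space_iff)
  qed
  define I where "I i = (LINT x:Omega X d s lam i|lebesgue. h i x)" for i
  have I_eq: "I i = (LINT x|N. indicator (argmax_region N (\<lambda>i x. u $ i * h i x) i) x * h i x)" for i
    unfolding I_def Omega_eq[symmetric] LINT_N[symmetric] set_lebesgue_integral_def
    using Omega_sub[of i]
    by (intro Bochner_Integration.integral_cong) (auto simp: indicator_def)

  \<comment> \<open>Excess demands and the city-wise Walras law\<close>
  define am mm where "am i = demand_a \<alpha> q (p i) 1" and "mm i = demand_m \<alpha> q (p i) 1" for i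
  have am: "demand_a \<alpha> q (p i) w = am i * w" and mm: "demand_m \<alpha> q (p i) w = mm i * w" for i w
    unfolding am_def mm_def by (rule demand_a_eq, rule demand_m_eq)
  have rural_income: "rural_income \<delta> d s ya pr x i = p i * (ya x / shipping \<delta> d x (s i))" for x i
    by (simp add: rural_income_def p_def)
  \<comment> \<open>Demand is linear in income, so each rural integral is a constant multiple of the
    single quantity \<open>I i\<close>. \<open>W i\<close> is the contribution of city
    \<open>i\<close> to the manufactured excess demand.\<close>
  define Z where "Z i = am i * (q * ym i) * LM i + (am i * p i - 1) * I i" for i
  define W where "W i = (mm i * (q * ym i) - ym i) * LM i + mm i * p i * I i" for i
  have Z_eq: "excess_agricultural \<alpha> \<delta> X d s ya ym LA LM pr i = Z i" for i
  proof -
    have "(LINT x:Omega X d s lam i|lebesgue.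
        (demand_a \<alpha> q (p i) (rural_income \<delta> d s ya pr x i) - ya x / shipping \<delta> d x (s i)) * LA x)
      = (LINT x:Omega X d s lam i|lebesgue. (am i * p i - 1) * h i x)"
      using Omega_sets
      by (intro set_lebesgue_integral_cong)
        (auto simp: am rural_income h_def algebra_simps diff_divide_distrib)
    then show ?thesis
      unfolding excess_agricultural_def Z_def I_def lam_def[symmetric] p_def[symmetric] q_def[symmetric]
      by (simp add: am urban_income_def q_def[symmetric])
  qed
  have W_eq: "excess_manufactured \<alpha> \<delta> X d s ya ym LA LM pr = (\<Sum>i\<in>UNIV. W i)"
  proof -
    have "(LINT x:Omega X d s lam i|lebesgue. demand_m \<alpha> q (p i) (rural_income \<delta> d s ya pr x i) * LA x)
      = (LINT x:Omega X d s lam i|lebesgue. mm i * p i * h i x)" for i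
      using Omega_sets
      by (intro set_lebesgue_integral_cong)
        (auto simp: mm rural_income h_def)
    then show ?thesis
      unfolding excess_manufactured_def W_def I_def lam_def[symmetric] p_def[symmetric] q_def[symmetric]
      by (simp add: mm urban_income_def q_def[symmetric])
  qed

  have walras: "p i * Z i + q * W i = 0" for i
  proof -
    have "p i * am i + q * mm i = 1"
      using budget_identity[OF q p, of i \<alpha> 1] by (simp add: am_def mm_def)
    then have budget: "q * mm i = 1 - p i * am i" by linarith
    \<comment> \<open>Urban and rural terms are grouped separately; each group contains the budget
      defect \<open>p i * am i + q * mm i - 1\<close>, which is zero.\<close>
    have "p i * Z i + q * W i =
        q * ym i * LM i * (p i * am i + q * mm i - 1) + p i * I i * (p i * am i - 1 + q * mm i)"
      unfolding Z_def W_def by (simp add: algebra_simps)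
    then show ?thesis unfolding budget by simp
  qed

  \<comment> \<open>The gradient of the potential\<close>
  have dP: "((\<lambda>z. fst z $ i) has_derivative (\<lambda>k. fst k $ i)) (at pr)" for i
    by (intro bounded_linear_imp_has_derivative bounded_linear_compose[OF bounded_linear_vec_nth]
        bounded_linear_fst)
  have dQ: "(snd has_derivative snd) (at pr)"
    by (intro bounded_linear_imp_has_derivative bounded_linear_snd)
  have dB: "((\<lambda>z. price_index \<alpha> (snd z) (fst z $ i)) has_derivative
      (\<lambda>k. - B i * (mm i * snd k + am i * fst k $ i))) (at pr)" for i
    using has_derivative_price_index[OF dP dQ, of i \<alpha>] \<alpha> p[of i] q
    by (simp add: B_def mm_def am_def p_def q_def)
  have dU: "(U has_derivative
      (\<lambda>k. \<chi> i. B i * (fst k $ i - p i * (mm i * snd k + am i * fst k $ i)))) (at pr)"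
    unfolding U_def[abs_def]
    by (rule has_derivative_eq_rhs, rule has_derivative_vec_lambda,
        rule has_derivative_mult[OF dB dP])
      (simp add: fun_eq_iff vec_eq_iff algebra_simps flip: B_def p_def q_def)
  have dRural: "((\<lambda>z. LINT x:X|lebesgue. rural_utility \<alpha> \<delta> d s ya x z * LA x) has_derivative
      (\<lambda>k. \<Sum>i\<in>UNIV. B i * (fst k $ i - p i * (mm i * snd k + am i * fst k $ i)) * I i)) (at pr)"
  proof -
    have rural_N: "(LINT x:X|lebesgue. rural_utility \<alpha> \<delta> d s ya x z * LA x)
        = (LINT x|N. Max (range (\<lambda>i. U z $ i * h i x)))" for z
      unfolding LINT_N by (intro Bochner_Integration.integral_cong rural) (auto simp: spaceN)
    have "((\<lambda>v. LINT x|N. Max (range (\<lambda>i. v $ i * h i x))) has_derivative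
        (\<lambda>k. \<Sum>i\<in>UNIV. k $ i * I i)) (at (U pr))"
      using has_derivative_integral_Max[OF h_int no_tie] unfolding I_eq u_def .
    from has_derivative_compose[OF dU this] show ?thesis
      unfolding rural_N by simp
  qed
  have dUrban: "((\<lambda>z. \<Sum>i\<in>UNIV. utility \<alpha> (snd z) (fst z $ i) (urban_income ym z i) * LM i)
      has_derivative (\<lambda>k. \<Sum>i\<in>UNIV.
        B i * (snd k - q * (mm i * snd k + am i * fst k $ i)) * ym i * LM i)) (at pr)"
    unfolding utility_eq urban_income_def
    by (rule has_derivative_sum, rule has_derivative_eq_rhs,
        (rule has_derivative_mult_left has_derivative_mult dB dQ)+)
      (simp add: fun_eq_iff algebra_simps flip: B_def p_def q_def)

  \<comment> \<open>Differentiating incomes with the index held fixed gives the supply terms, and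
    differentiating the index gives the demand terms by Roy's identity. Both carry the factor
    \<open>B i\<close>, and the minus signs in the potential turn the total into demand minus
    supply.\<close>
  define G where "G = ((\<chi> i. B i * Z i), \<Sum>i\<in>UNIV. B i * W i)"
  have "GDERIV (potential \<alpha> \<delta> X d s ya ym LA LM) pr :> G"
    unfolding gderiv_def potential_def[abs_def]
  proof (rule has_derivative_eq_rhs, rule has_derivative_diff[OF has_derivative_minus[OF dUrban] dRural])
    show "(\<lambda>k. - (\<Sum>i\<in>UNIV. B i * (snd k - q * (mm i * snd k + am i * fst k $ i)) * ym i * LM i)
          - (\<Sum>i\<in>UNIV. B i * (fst k $ i - p i * (mm i * snd k + am i * fst k $ i)) * I i))
        = (\<lambda>k. inner k G)"
      unfolding fun_eq_iff G_def inner_prod_def inner_vec_def Z_def W_def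
      by (simp add: sum_distrib_left sum_subtractf[symmetric] sum.distrib[symmetric]
          sum_negf[symmetric] algebra_simps)
  qed
  moreover have "equilibrium \<alpha> \<delta> X d s ya ym LA LM pr \<longleftrightarrow> G = 0"
  proof -
    have W0: "W i = 0" if "Z i = 0" for i
      using walras[of i] that q by simp
    have "G = 0 \<longleftrightarrow> (\<forall>i. Z i = 0) \<and> (\<Sum>i\<in>UNIV. B i * W i) = 0"
      using B by (simp add: G_def prod_eq_iff vec_eq_iff less_imp_neq[symmetric])
    also have "\<dots> \<longleftrightarrow> (\<forall>i. Z i = 0) \<and> (\<Sum>i\<in>UNIV. W i) = 0"
      using W0 by auto
    finally show ?thesis by (simp add: equilibrium_def Z_eq W_eq)
  qed
  ultimately show ?thesis by blast
qed

end
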